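(* Let $N\ge 1$, let $P_0,P_1,\dots,P_{N+1}$ be the monic polynomials associated with a persymmetric Jacobi matrix with recurrence coefficients $b_0,\dots,b_N$ and $u_1,\dots,u_N$, let $x_0<x_1<\dots<x_N$ be its spectral points and $w_0,\dots,w_N$ its weights (all as defined in the context). (i) If $N=2L+1$ is odd, then the polynomials $P_n(x)$, $n=0,1,\dots,L$, are orthogonal with respect to the weights $w_0,w_2,\dots,w_{2L}$ on the grid $x_0,x_2,\dots,x_{2L}$, and they are also orthogonal with respect to the weights $w_1,w_3,\dots,w_{2L+1}$ on the grid $x_1,x_3,\dots,x_{2L+1}$. That is, for all $n,m\in\{0,\dots,L\}$, each of the sums $$\sum_{s=0}^{L} w_{2s}P_n(x_{2s})P_m(x_{2s}),\qquad \sum_{s=0}^{L} w_{2s+1}P_n(x_{2s+1})P_m(x_{2s+1})$$ is $0$ if $n\neq m$ and nonzero if $n=m$. (ii) If $N=2L$ is even, then the polynomials $P_n(x)$, $n=0,1,\dots,L-1$, are orthogonal with respect to the weights $w_1,w_3,\dots,w_{2L-1}$ on the grid $x_1,x_3,\dots,x_{2L-1}$. That is, for all $n,m\in\{0,\dots,L-1\}$, $$\sum_{s=0}^{L-1} w_{2s+1}P_n(x_{2s+1})P_m(x_{2s+1})$$ is $0$ if $n\ne m$ and nonzero if $n=m$.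
   Context: Let $b_0,\dots,b_N$ be real numbers and $u_1,\dots,u_N$ be positive real numbers. The associated Jacobi matrix is the $(N+1)\times(N+1)$ real symmetric tridiagonal matrix with diagonal entries $b_0,\dots,b_N$ and off-diagonal entries $a_1,\dots,a_N$ with $a_n^2=u_n$. Persymmetric (invariant under reflection in the anti-diagonal) means $b_{N-i}=b_i$ for $i=0,\dots,N$ and $a_{N+1-i}=a_i$ (so $u_{N+1-i}=u_i$) for $i=1,\dots,N$. The monic polynomials $P_n$ are defined by $P_{-1}=0$, $P_0=1$ and $$P_{n+1}(x)+b_nP_n(x)+u_nP_{n-1}(x)=xP_n(x),\qquad n=0,\dots,N$$ (with the convention $u_0=0$). The spectral points $x_0<x_1<\dots<x_N$ are the eigenvalues of the matrix, which are real and distinct and are exactly the roots of $P_{N+1}(x)=(x-x_0)(x-x_1)\cdots(x-x_N)$. The weights are $$w_s=\frac{h_N}{P_N(x_s)\,P_{N+1}'(x_s)},\quad s=0,\dots,N,\qquad h_n=u_1u_2\cdots u_n .$$ With these weights $\sum_{s=0}^N w_sP_n(x_s)P_m(x_s)=h_n\delta_{nm}$ for $0\le n,m\le N$. *)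

theory Defs
  imports Complex_Main "Jordan_Normal_Form.Char_Poly"
begin

text \<open>
  The coefficients are functions on \<^typ>\<open>nat\<close> of which only \<open>b 0, \<dots>, b N\<close>, \<open>a 1, \<dots>, a N\<close> and
  \<open>u 1, \<dots>, u N\<close> are relevant. With rows and columns numbered from 0, the entry \<open>a n\<close> sits in the
  positions \<open>(n - 1, n)\<close> and \<open>(n, n - 1)\<close>.
\<close>

definition jacobi_mat :: "nat \<Rightarrow> (nat \<Rightarrow> real) \<Rightarrow> (nat \<Rightarrow> real) \<Rightarrow> real mat" where
  "jacobi_mat N b a = mat (N + 1) (N + 1) (\<lambda>(i, j).
     if i = j then b i
     else if j = i + 1 then a j
     else if i = j + 1 then a i
     else 0)"

definition persymmetric_coeffs :: "nat \<Rightarrow> (nat \<Rightarrow> real) \<Rightarrow> (nat \<Rightarrow> real) \<Rightarrow> bool" where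
  "persymmetric_coeffs N b a \<longleftrightarrow>
     (\<forall>i\<in>{0..N}. b (N - i) = b i) \<and> (\<forall>i\<in>{1..N}. a (N + 1 - i) = a i)"

text \<open>
  The second equation is \<open>P (n + 1) + b n P n + u n P (n - 1) = x P n\<close> at \<open>n = 0\<close>, where the term
  with \<open>P (-1) = 0\<close> drops out.
\<close>

fun jacobi_poly :: "(nat \<Rightarrow> real) \<Rightarrow> (nat \<Rightarrow> real) \<Rightarrow> nat \<Rightarrow> real poly" where
  "jacobi_poly b u 0 = 1"
| "jacobi_poly b u (Suc 0) = [:- b 0, 1:]"
| "jacobi_poly b u (Suc (Suc n)) =
     [:- b (Suc n), 1:] * jacobi_poly b u (Suc n) - Polynomial.smult (u (Suc n)) (jacobi_poly b u n)"

definition spectral_points :: "nat \<Rightarrow> (nat \<Rightarrow> real) \<Rightarrow> (nat \<Rightarrow> real) \<Rightarrow> (nat \<Rightarrow> real) \<Rightarrow> bool" where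
  "spectral_points N b a x \<longleftrightarrow>
     strict_mono_on {0..N} x \<and> x ` {0..N} = {k. eigenvalue (jacobi_mat N b a) k}"

definition jacobi_norm :: "(nat \<Rightarrow> real) \<Rightarrow> nat \<Rightarrow> real" where
  "jacobi_norm u n = (\<Prod>i=1..n. u i)"

definition jacobi_weight ::
    "nat \<Rightarrow> (nat \<Rightarrow> real) \<Rightarrow> (nat \<Rightarrow> real) \<Rightarrow> (nat \<Rightarrow> real) \<Rightarrow> nat \<Rightarrow> real" where
  "jacobi_weight N b u x s =
     jacobi_norm u N /
       (poly (jacobi_poly b u N) (x s) * poly (pderiv (jacobi_poly b u (N + 1))) (x s))"

end

theory Submission
  imports Defs
begin

text \<open>
  At a spectral point \<open>y\<close> persymmetry gives \<open>h k P (N - k) y = P N y P k y\<close>. For \<open>k = N\<close> this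
  reads \<open>(P N y)\<^sup>2 = h N\<close>, so the weights are \<open>w s = P N (x s) / P' (N + 1) (x s)\<close>, and since they
  are positive and \<open>P' (N + 1)\<close> alternates in sign along its zeros,
  \<open>P N (x s) = (- 1) ^ (N - s) * sqrt (h N)\<close>. Lagrange interpolation evaluates
  \<open>\<Sum> q (x s) / P' (N + 1) (x s)\<close> as the coefficient of \<open>q\<close> at degree \<open>N\<close>. Applied to \<open>P (N - n) P m\<close>
  this yields the orthogonality of the \<open>P n\<close> on the whole grid; applied to \<open>q = P n P m\<close> it shows
  that the alternating sums \<open>\<Sum> (- 1) ^ s w s q (x s)\<close> vanish when \<open>n + m < N\<close>. Hence each of the
  two half grids carries exactly half of the full sum.
\<close>

section \<open>Monic polynomials of the three-term recurrence\<close>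

lemma jacobi_poly_Suc:
  assumes "n \<ge> 1"
  shows "jacobi_poly b u (Suc n) =
    [:- b n, 1:] * jacobi_poly b u n - Polynomial.smult (u n) (jacobi_poly b u (n - 1))"
  using assms by (cases n) auto

lemma jacobi_poly_monic:
  "degree (jacobi_poly b u n) = n \<and> lead_coeff (jacobi_poly b u n) = 1"
proof (induction n rule: induct_nat_012)
  case (ge2 n)
  let ?p = "[:- b (Suc n), 1:] * jacobi_poly b u (Suc n)"
  let ?q = "Polynomial.smult (u (Suc n)) (jacobi_poly b u n)"
  have nz: "jacobi_poly b u (Suc n) \<noteq> 0" using ge2 by auto
  have "degree ?p = degree [:- b (Suc n), 1:] + degree (jacobi_poly b u (Suc n))"
    using nz by (intro degree_mult_eq) auto
  then have dp: "degree ?p = Suc (Suc n)" using ge2 by simp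
  have lp: "lead_coeff ?p = 1"
    using ge2 by (subst lead_coeff_mult) auto
  have dq: "degree ?q < Suc (Suc n)" using ge2 degree_smult_le[of "u (Suc n)" "jacobi_poly b u n"] by linarith
  have eq: "jacobi_poly b u (Suc (Suc n)) = ?p + (- ?q)" by simp
  have d: "degree (jacobi_poly b u (Suc (Suc n))) = Suc (Suc n)"
    unfolding eq using dp dq by (subst degree_add_eq_left) (auto simp del: mult_pCons_left)
  have "coeff ?q (Suc (Suc n)) = 0" using dq by (rule coeff_eq_0)
  then have "coeff (jacobi_poly b u (Suc (Suc n))) (Suc (Suc n)) = 1"
    unfolding eq using lp dp by (simp del: mult_pCons_left)
  with d show ?case by simp
qed auto

lemma degree_jacobi_poly [simp]: "degree (jacobi_poly b u n) = n"
  and lead_coeff_jacobi_poly [simp]: "coeff (jacobi_poly b u n) n = 1"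
  using jacobi_poly_monic[of b u n] by auto

text \<open>Confluent Christoffel-Darboux: raising the index turns the expression \<open>W\<close>
  into \<open>(P (n + 1) y)\<^sup>2 + u (n + 1) * W\<close>, so positivity propagates from
  \<open>W = 1\<close> at index 0. At a zero of \<open>P (n + 1)\<close> only the first product
  survives, which fixes the sign of \<open>P n\<close> there.\<close>

lemma jacobi_poly_wronskian_pos:
  assumes "\<forall>i\<in>{1..n}. u i > 0"
  shows "poly (pderiv (jacobi_poly b u (Suc n))) y * poly (jacobi_poly b u n) y
    - poly (pderiv (jacobi_poly b u n)) y * poly (jacobi_poly b u (Suc n)) y > 0"
  using assms
proof (induction n)
  case 0
  then show ?case by (simp add: pderiv_pCons)
next
  case (Suc n)
  define p q where "p = jacobi_poly b u n" and "q = jacobi_poly b u (Suc n)"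
  have W: "poly (pderiv q) y * poly p y - poly (pderiv p) y * poly q y > 0" (is "?W > 0")
    using Suc by (simp add: p_def q_def)
  have "poly (pderiv (jacobi_poly b u (Suc (Suc n)))) y * poly q y
      - poly (pderiv q) y * poly (jacobi_poly b u (Suc (Suc n))) y
      = (poly q y)\<^sup>2 + u (Suc n) * ?W"
    unfolding jacobi_poly.simps(3) p_def[symmetric] q_def[symmetric] pderiv_diff pderiv_mult pderiv_smult
    by (simp add: pderiv_pCons algebra_simps power2_eq_square)
  moreover have "u (Suc n) * ?W > 0" using W Suc.prems by simp
  ultimately show ?case unfolding q_def by (smt (verit) zero_le_power2)
qed

text \<open>At a zero \<open>y\<close> of \<open>P (N + 1)\<close>, running the recurrence backwards from \<open>P N\<close> reproduces, by
  persymmetry, the forward recurrence up to the factor \<open>P N y\<close>.\<close>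

lemma jacobi_poly_reflect:
  assumes b: "\<And>i. i \<le> N \<Longrightarrow> b (N - i) = b i"
    and u: "\<And>i. 1 \<le> i \<Longrightarrow> i \<le> N \<Longrightarrow> u (N + 1 - i) = u i"
    and root: "poly (jacobi_poly b u (Suc N)) y = 0"
    and "k \<le> N"
  shows "jacobi_norm u k * poly (jacobi_poly b u (N - k)) y
    = poly (jacobi_poly b u N) y * poly (jacobi_poly b u k) y"
  using \<open>k \<le> N\<close>
proof (induction k rule: induct_nat_012)
  case 0
  then show ?case by (simp add: jacobi_norm_def)
next
  case 1
  \<comment> \<open>This is the recurrence at index \<open>N\<close>, whose top term
    \<open>P (N + 1) y\<close> vanishes.\<close>
  then have "0 = (y - b N) * poly (jacobi_poly b u N) y - u N * poly (jacobi_poly b u (N - 1)) y"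
    using root by (simp add: jacobi_poly_Suc algebra_simps)
  moreover have "b N = b 0" using b[of 0] by simp
  moreover have "u N = u 1" using u[of 1] 1 by simp
  ultimately show ?case by (simp add: jacobi_norm_def algebra_simps)
next
  case (ge2 k)
  let ?P = "\<lambda>n. poly (jacobi_poly b u n) y"
  define j where "j = N - Suc k"
  have j: "j \<ge> 1" "N - k = Suc j" "N - Suc k = j" "N - Suc (Suc k) = j - 1"
    using ge2.prems by (auto simp: j_def)
  \<comment> \<open>The recurrence at \<open>j = N - k - 1\<close> is solved for its lowest term.
    Reflection sends \<open>b j\<close> to \<open>b (k + 1)\<close> but \<open>u j\<close> to
    \<open>u (k + 2)\<close>, since \<open>u\<close> is numbered from 1.\<close>
  have rec: "u j * ?P (j - 1) = (y - b j) * ?P j - ?P (Suc j)"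
    using j(1) by (simp add: jacobi_poly_Suc algebra_simps)
  have bj: "b j = b (Suc k)" unfolding j_def using b ge2.prems by simp
  have uj: "u j = u (Suc (Suc k))" using u[of "Suc (Suc k)"] ge2.prems by (simp add: j_def)
  have h: "jacobi_norm u (Suc k) = jacobi_norm u k * u (Suc k)"
    "jacobi_norm u (Suc (Suc k)) = jacobi_norm u (Suc k) * u (Suc (Suc k))"
    by (simp_all add: jacobi_norm_def)
  have IH: "jacobi_norm u k * ?P (Suc j) = ?P N * ?P k"
    "jacobi_norm u (Suc k) * ?P j = ?P N * ?P (Suc k)"
    using ge2 j by simp_all
  have "jacobi_norm u (Suc (Suc k)) * ?P (j - 1) = jacobi_norm u (Suc k) * (u j * ?P (j - 1))"
    by (simp add: h(2) uj)
  also have "\<dots> = (y - b j) * (jacobi_norm u (Suc k) * ?P j)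
      - u (Suc k) * (jacobi_norm u k * ?P (Suc j))"
    unfolding rec h(1) by (simp add: algebra_simps)
  also have "\<dots> = ?P N * ?P (Suc (Suc k))"
    unfolding IH bj by (simp add: algebra_simps)
  finally show ?case by (simp only: j)
qed

section \<open>Lagrange interpolation and signs at distinct nodes\<close>

text \<open>The sum is the divided difference of \<open>q\<close> at all the nodes, that is, the top
  coefficient of its Lagrange interpolant. The degree bound makes the interpolant equal to
  \<open>q\<close>.\<close>

lemma sum_divided_difference:
  fixes x :: "'a \<Rightarrow> 'b::field"
  assumes "finite A" "inj_on x A" "degree q < card A"
  shows "(\<Sum>s\<in>A. poly q (x s) / (\<Prod>j\<in>A - {s}. x s - x j)) = coeff q (card A - 1)"
proof -
  \<comment> \<open>\<open>l s\<close> is the Lagrange basis polynomial of the node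
    \<open>x s\<close>, scaled by the value of \<open>q\<close> there.\<close>
  define l where "l = (\<lambda>s. Polynomial.smult (poly q (x s) / (\<Prod>j\<in>A - {s}. x s - x j))
    (\<Prod>j\<in>A - {s}. [:- x j, 1:]))"
  have deg: "degree (\<Prod>j\<in>A - {s}. [:- x j, 1:]) = card A - 1"
    and lead: "coeff (\<Prod>j\<in>A - {s}. [:- x j, 1:]) (card A - 1) = 1" if "s \<in> A" for s
  proof -
    show d: "degree (\<Prod>j\<in>A - {s}. [:- x j, 1:]) = card A - 1"
      using that assms(1) by (subst degree_prod_eq_sum_degree) auto
    have "lead_coeff (\<Prod>j\<in>A - {s}. [:- x j, 1:]) = 1"
      by (subst lead_coeff_prod) simp
    then show "coeff (\<Prod>j\<in>A - {s}. [:- x j, 1:]) (card A - 1) = 1"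
      by (simp add: d)
  qed
  have val: "poly (\<Sum>s\<in>A. l s) (x t) = poly q (x t)" if t: "t \<in> A" for t
  proof -
    have z: "poly (l s) (x t) = 0" if "s \<in> A - {t}" for s
      using that t assms(1) by (auto simp: l_def poly_prod)
    have nz: "(\<Prod>j\<in>A - {t}. x t - x j) \<noteq> 0"
      using assms t by (auto simp: inj_on_def)
    have "poly (\<Sum>s\<in>A. l s) (x t) = (\<Sum>s\<in>A. poly (l s) (x t))" by (simp add: poly_sum)
    also have "\<dots> = poly (l t) (x t)"
      using assms(1) t z by (simp add: sum.remove[of A t])
    also have "\<dots> = poly q (x t)" using nz by (simp add: l_def poly_prod)
    finally show ?thesis .
  qed
  have "q = (\<Sum>s\<in>A. l s)"
  proof (rule poly_eqI_degree[of "x ` A"])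
    show "degree q < card (x ` A)" using assms by (simp add: card_image)
    have "degree (\<Sum>s\<in>A. l s) \<le> card A - 1"
      using assms(1) deg by (intro degree_sum_le) (auto simp: l_def intro: order.trans[OF degree_smult_le])
    then show "degree (\<Sum>s\<in>A. l s) < card (x ` A)"
      using assms by (simp add: card_image)
  qed (use val in auto)
  then have "coeff q (card A - 1) = (\<Sum>s\<in>A. coeff (l s) (card A - 1))"
    by (metis coeff_sum)
  also have "\<dots> = (\<Sum>s\<in>A. poly q (x s) / (\<Prod>j\<in>A - {s}. x s - x j))"
    by (intro sum.cong refl) (simp only: l_def coeff_smult lead mult_1_right)
  finally show ?thesis by simp
qed

lemma poly_pderiv_prod_linear:
  fixes x :: "'a \<Rightarrow> 'b::field"
  assumes "finite A" "s \<in> A"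
  shows "poly (pderiv (\<Prod>j\<in>A. [:- x j, 1:])) (x s) = (\<Prod>j\<in>A - {s}. x s - x j)"
  using assms by (simp add: prod.remove[of A s] pderiv_mult pderiv_pCons poly_prod
      del: mult_pCons_left)

lemma monic_eq_prod_linear:
  fixes p :: "'b::field poly"
  assumes "finite A" "inj_on x A" "\<And>s. s \<in> A \<Longrightarrow> poly p (x s) = 0"
    and "degree p = card A" "lead_coeff p = 1"
  shows "p = (\<Prod>j\<in>A. [:- x j, 1:])"
proof (rule poly_eqI_degree_lead_coeff[where A = "x ` A" and n = "card A"])
  have d: "degree (\<Prod>j\<in>A. [:- x j, 1:]) = card A"
    by (subst degree_prod_eq_sum_degree) auto
  have "lead_coeff (\<Prod>j\<in>A. [:- x j, 1:]) = 1"
    by (subst lead_coeff_prod) simp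
  then show "coeff p (card A) = coeff (\<Prod>j\<in>A. [:- x j, 1:]) (card A)"
    using assms d by simp
  show "degree (\<Prod>j\<in>A. [:- x j, 1:]) \<le> card A" using d by simp
qed (use assms in \<open>auto simp: card_image poly_prod\<close>)

text \<open>Exactly the \<open>N - s\<close> factors with \<open>j > s\<close> are negative.\<close>

lemma sgn_prod_diff_strict_mono_on:
  fixes x :: "nat \<Rightarrow> 'a::linordered_idom"
  assumes "strict_mono_on {0..N} x" "s \<le> N"
  shows "sgn (\<Prod>j\<in>{0..N} - {s}. x s - x j) = (- 1) ^ (N - s)"
proof -
  have split: "{0..N} - {s} = {0..<s} \<union> {s<..N}" using assms(2) by auto
  have "(\<Prod>j\<in>{0..N} - {s}. sgn (x s - x j))
      = (\<Prod>j\<in>{0..<s}. sgn (x s - x j)) * (\<Prod>j\<in>{s<..N}. sgn (x s - x j))"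
    unfolding split by (rule prod.union_disjoint) auto
  also have "(\<Prod>j\<in>{0..<s}. sgn (x s - x j)) = (\<Prod>j\<in>{0..<s}. 1)"
  proof (rule prod.cong)
    fix j assume "j \<in> {0..<s}"
    then have "x j < x s" using assms(2) by (intro strict_mono_onD[OF assms(1)]) auto
    then show "sgn (x s - x j) = 1" by simp
  qed simp
  also have "(\<Prod>j\<in>{s<..N}. sgn (x s - x j)) = (\<Prod>j\<in>{s<..N}. - 1)"
  proof (rule prod.cong)
    fix j assume "j \<in> {s<..N}"
    then have "x s < x j" using assms(2) by (intro strict_mono_onD[OF assms(1)]) auto
    then show "sgn (x s - x j) = - 1" by simp
  qed simp
  finally have "(\<Prod>j\<in>{0..N} - {s}. sgn (x s - x j)) = (- 1) ^ (N - s)" by simp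
  moreover have "sgn (\<Prod>j\<in>B. x s - x j) = (\<Prod>j\<in>B. sgn (x s - x j))" for B
    by (induction B rule: infinite_finite_induct) (simp_all add: sgn_mult)
  ultimately show ?thesis by simp
qed

section \<open>Eigenvalues of the Jacobi matrix as zeros of \<open>P (N + 1)\<close>\<close>

lemma jacobi_mat_mult_row:
  assumes "v \<in> carrier_vec (N + 1)" "i \<le> N"
  shows "(jacobi_mat N b a *\<^sub>v v) $ i =
    (if i = 0 then 0 else a i * v $ (i - 1)) + b i * v $ i
      + (if i = N then 0 else a (i + 1) * v $ (i + 1))"
proof -
  have "(jacobi_mat N b a *\<^sub>v v) $ i = (\<Sum>j<N + 1. jacobi_mat N b a $$ (i, j) * v $ j)"
    using assms by (auto simp: jacobi_mat_def scalar_prod_def atLeast0LessThan intro!: sum.cong)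
  \<comment> \<open>At \<open>i = 0\<close> truncated subtraction gives \<open>i - 1 = i\<close>;
    the inner test keeps the first summand from adding a spurious diagonal term.\<close>
  also have "\<dots> = (\<Sum>j<N + 1. (if j = i - 1 then (if i = 0 then 0 else a i * v $ (i - 1)) else 0)
      + (if j = i then b i * v $ i else 0) + (if j = i + 1 then a (i + 1) * v $ (i + 1) else 0))"
    using assms(2) by (intro sum.cong) (auto simp: jacobi_mat_def)
  also have "\<dots> = (if i = 0 then 0 else a i * v $ (i - 1)) + b i * v $ i
      + (if i = N then 0 else a (i + 1) * v $ (i + 1))"
    using assms(2) by (simp only: sum.distrib sum.delta finite_lessThan) auto
  finally show ?thesis .
qed

text \<open>The recurrence for \<open>P\<close> is the eigenvector equation read row by row: an eigenvector \<open>v\<close> satisfies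
  \<open>a 1 \<cdots> a n v n = P n k v 0\<close>.\<close>

lemma eigenvalue_jacobi_mat_root:
  assumes a: "\<forall>n\<in>{1..N}. a n \<noteq> 0" and u: "\<forall>n\<in>{1..N}. (a n)\<^sup>2 = u n"
    and "eigenvalue (jacobi_mat N b a) k"
  shows "poly (jacobi_poly b u (Suc N)) k = 0"
proof -
  let ?P = "\<lambda>n. poly (jacobi_poly b u n) k"
  define c where "c n = (\<Prod>i=1..n. a i)" for n
  have c_Suc: "c (Suc n) = c n * a (Suc n)" for n by (simp add: c_def)
  have c_nz: "c n \<noteq> 0" if "n \<le> N" for n using a that by (auto simp: c_def)
  obtain v where v: "v \<in> carrier_vec (N + 1)" "v \<noteq> 0\<^sub>v (N + 1)" "jacobi_mat N b a *\<^sub>v v = k \<cdot>\<^sub>v v"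
    using assms(3) by (auto simp: eigenvalue_def eigenvector_def jacobi_mat_def)
  have row: "(if i = 0 then 0 else a i * v $ (i - 1)) + b i * v $ i
      + (if i = N then 0 else a (i + 1) * v $ (i + 1)) = k * v $ i" if "i \<le> N" for i
    using jacobi_mat_mult_row[OF v(1) that, of b a] v(1) that by (simp add: v(3))
  have comp: "c n * v $ n = ?P n * v $ 0" if "n \<le> N" for n
    using that
  proof (induction n rule: induct_nat_012)
    case 0
    then show ?case by (simp add: c_def)
  next
    case 1
    then show ?case using row[of 0] by (simp add: c_def algebra_simps)
  next
    case (ge2 n)
    have IH: "c n * v $ n = ?P n * v $ 0" "c (Suc n) * v $ Suc n = ?P (Suc n) * v $ 0"
      using ge2 by simp_all
    have r: "a (Suc (Suc n)) * v $ Suc (Suc n) = (k - b (Suc n)) * v $ Suc n - a (Suc n) * v $ n"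
      using row[of "Suc n"] ge2.prems by (simp add: algebra_simps)
    have un: "u (Suc n) = a (Suc n) * a (Suc n)"
      using u ge2.prems by (auto simp: power2_eq_square)
    have "c (Suc (Suc n)) * v $ Suc (Suc n) = c (Suc n) * (a (Suc (Suc n)) * v $ Suc (Suc n))"
      by (simp add: c_Suc)
    also have "\<dots> = (k - b (Suc n)) * (c (Suc n) * v $ Suc n) - u (Suc n) * (c n * v $ n)"
      unfolding r un c_Suc[of n] by (simp add: algebra_simps)
    also have "\<dots> = ?P (Suc (Suc n)) * v $ 0"
      unfolding IH by (simp add: algebra_simps)
    finally show ?case .
  qed
  have "v $ 0 \<noteq> 0"
  proof
    assume "v $ 0 = 0"
    then have "v $ n = 0" if "n \<le> N" for n using comp[OF that] c_nz[OF that] by simp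
    then have "v = 0\<^sub>v (N + 1)" using v(1) by (intro eq_vecI) auto
    with v(2) show False by simp
  qed
  \<comment> \<open>The last row has no right neighbour, so the value that the recurrence assigns to
    the missing component is zero. For \<open>N = 0\<close> the first row is also the last one and
    has no left neighbour either.\<close>
  moreover have "?P (Suc N) * v $ 0 = 0"
  proof (cases N)
    case 0
    then show ?thesis using row[of 0] by (auto simp: algebra_simps)
  next
    case (Suc n)
    have IH: "c n * v $ n = ?P n * v $ 0" "c N * v $ N = ?P N * v $ 0"
      using comp Suc by simp_all
    have r: "(k - b N) * v $ N - a N * v $ n = 0"
      using row[of N] Suc by (simp add: algebra_simps)
    have un: "u N = a N * a N" using u Suc by (auto simp: power2_eq_square)
    have cN: "c N = c n * a N" using c_Suc[of n] Suc by simp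
    have "?P (Suc N) * v $ 0 = (k - b N) * (?P N * v $ 0) - u N * (?P n * v $ 0)"
      by (simp add: Suc algebra_simps)
    also have "\<dots> = c N * ((k - b N) * v $ N - a N * v $ n)"
      unfolding IH[symmetric] un cN by (simp add: algebra_simps)
    finally show ?thesis by (simp add: r)
  qed
  ultimately show ?thesis by simp
qed

section \<open>Sums over the spectral grid and its two halves\<close>

lemma sum_split_even_odd:
  fixes f :: "nat \<Rightarrow> 'a::comm_monoid_add"
  shows "(\<Sum>s=0..2 * L + 1. f s) = (\<Sum>s=0..L. f (2 * s)) + (\<Sum>s=0..L. f (2 * s + 1))"
    and "(\<Sum>s=0..2 * L. f s) = (\<Sum>s=0..L. f (2 * s)) + (\<Sum>s=0..<L. f (2 * s + 1))"
  by (induction L) (simp_all add: algebra_simps)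

context
  fixes N :: nat and a b u x :: "nat \<Rightarrow> real"
  assumes u_pos: "\<forall>n\<in>{1..N}. u n > 0"
    and a_sq: "\<forall>n\<in>{1..N}. (a n)\<^sup>2 = u n"
    and persym: "persymmetric_coeffs N b a"
    and spec: "spectral_points N b a x"
begin

abbreviation (input) "P \<equiv> jacobi_poly b u"
abbreviation (input) "w \<equiv> jacobi_weight N b u x"

lemma jacobi_norm_pos: "n \<le> N \<Longrightarrow> jacobi_norm u n > 0"
  using u_pos by (auto simp: jacobi_norm_def intro!: prod_pos)

lemma spectral_root: "s \<le> N \<Longrightarrow> poly (P (Suc N)) (x s) = 0"
proof (rule eigenvalue_jacobi_mat_root)
  show "\<forall>n\<in>{1..N}. a n \<noteq> 0" using u_pos a_sq by fastforce
  show "\<forall>n\<in>{1..N}. (a n)\<^sup>2 = u n" by (fact a_sq)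
  show "s \<le> N \<Longrightarrow> eigenvalue (jacobi_mat N b a) (x s)"
    using spec by (auto simp: spectral_points_def)
qed

lemma spectral_strict_mono: "strict_mono_on {0..N} x"
  using spec by (simp add: spectral_points_def)

lemma spectral_inj: "inj_on x {0..N}"
  using spectral_strict_mono by (rule strict_mono_on_imp_inj_on)

text \<open>The \<open>N + 1\<close> distinct eigenvalues are zeros of a monic polynomial of degree
  \<open>N + 1\<close>, which therefore factors over them. This identifies the derivative in the
  weights with the denominators of Lagrange interpolation.\<close>

lemma pderiv_at_spectral:
  assumes "s \<le> N"
  shows "poly (pderiv (P (Suc N))) (x s) = (\<Prod>j\<in>{0..N} - {s}. x s - x j)"
proof -
  have "P (Suc N) = (\<Prod>j\<in>{0..N}. [:- x j, 1:])"
  proof (rule monic_eq_prod_linear)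
    show "poly (P (Suc N)) (x s) = 0" if "s \<in> {0..N}" for s
      using spectral_root that by simp
    show "degree (P (Suc N)) = card {0..N}" by (simp only: degree_jacobi_poly card_atLeastAtMost)
    show "lead_coeff (P (Suc N)) = 1" by (simp only: degree_jacobi_poly lead_coeff_jacobi_poly)
  qed (simp_all add: spectral_inj)
  then show ?thesis
    using poly_pderiv_prod_linear[of "{0..N}" s x] assms by (simp only: finite_atLeastAtMost atLeastAtMost_iff simp_thms le0)
qed

lemma jacobi_poly_reflect_spectral:
  assumes "s \<le> N" "k \<le> N"
  shows "jacobi_norm u k * poly (P (N - k)) (x s) = poly (P N) (x s) * poly (P k) (x s)"
proof (rule jacobi_poly_reflect[OF _ _ spectral_root[OF assms(1)] assms(2)])
  show "b (N - i) = b i" if "i \<le> N" for i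
    using persym that by (auto simp: persymmetric_coeffs_def)
  \<comment> \<open>Symmetry is assumed for \<open>a\<close> and passes to \<open>u\<close> by
    squaring.\<close>
  show "u (N + 1 - i) = u i" if "1 \<le> i" "i \<le> N" for i
  proof -
    have "N + 1 - i \<in> {1..N}" "i \<in> {1..N}" using that by auto
    then show ?thesis using persym a_sq by (metis persymmetric_coeffs_def)
  qed
qed

lemma jacobi_poly_last_sq: "s \<le> N \<Longrightarrow> (poly (P N) (x s))\<^sup>2 = jacobi_norm u N"
  using jacobi_poly_reflect_spectral[of s N] by (simp add: power2_eq_square)

lemma jacobi_poly_last:
  assumes "s \<le> N"
  shows "poly (P N) (x s) = (- 1) ^ (N - s) * sqrt (jacobi_norm u N)"
proof -
  let ?D = "poly (pderiv (P (Suc N))) (x s)"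
  \<comment> \<open>The Wronskian inequality at a zero of \<open>P (Suc N)\<close>: its second
    product vanishes.\<close>
  have "?D * poly (P N) (x s) > 0"
    using jacobi_poly_wronskian_pos[OF u_pos, of b "x s"] spectral_root[OF assms] by simp
  then have "sgn (poly (P N) (x s)) = sgn ?D"
    by (auto simp: sgn_if zero_less_mult_iff)
  also have "\<dots> = (- 1) ^ (N - s)"
    unfolding pderiv_at_spectral[OF assms]
    by (rule sgn_prod_diff_strict_mono_on[OF spectral_strict_mono assms])
  finally have sg: "sgn (poly (P N) (x s)) = (- 1) ^ (N - s)" .
  have "\<bar>poly (P N) (x s)\<bar> = sqrt (jacobi_norm u N)"
    using jacobi_poly_last_sq[OF assms] by (metis real_sqrt_abs)
  then show ?thesis using sg by (metis sgn_mult_abs)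
qed

lemma jacobi_weight_eq:
  assumes "s \<le> N"
  shows "w s = poly (P N) (x s) / (\<Prod>j\<in>{0..N} - {s}. x s - x j)"
proof -
  have "poly (P N) (x s) \<noteq> 0"
    using jacobi_poly_last_sq[OF assms] jacobi_norm_pos[of N] by auto
  then show ?thesis
    \<comment> \<open>Writing \<open>h N\<close> as the square of \<open>P N (x s)\<close> cancels
      the factor \<open>P N (x s)\<close> in the denominator.\<close>
    unfolding jacobi_weight_def jacobi_poly_last_sq[OF assms, symmetric]
    by (simp add: pderiv_at_spectral[OF assms, simplified] power2_eq_square del: jacobi_poly.simps
        flip: Suc_eq_plus1)
qed

lemma spectral_divided_difference:
  assumes "degree q \<le> N"
  shows "(\<Sum>s=0..N. poly q (x s) / (\<Prod>j\<in>{0..N} - {s}. x s - x j)) = coeff q N"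
  using sum_divided_difference[of "{0..N}" x q] spectral_inj assms by simp

lemma jacobi_orthogonality:
  assumes "n \<le> N" "m \<le> N"
  shows "(\<Sum>s=0..N. w s * poly (P n) (x s) * poly (P m) (x s))
    = (if n = m then jacobi_norm u n else 0)"
  using assms
proof (induction n m rule: linorder_wlog)
  case (sym n m)
  then show ?case by (simp add: mult_ac split: if_splits)
next
  \<comment> \<open>Here \<open>m\<close> is the smaller index, so \<open>P (N - n) * P m\<close>
    has degree \<open>N - n + m\<close>, at most \<open>N\<close>. The coefficient at
    \<open>N\<close> is thus the leading coefficient 1 when \<open>n = m\<close>, and 0
    otherwise.\<close>
  case (le m n)
  have "(\<Sum>s=0..N. w s * poly (P n) (x s) * poly (P m) (x s))
      = (\<Sum>s=0..N. jacobi_norm u n *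
          (poly (P (N - n) * P m) (x s) / (\<Prod>j\<in>{0..N} - {s}. x s - x j)))"
  proof (rule sum.cong)
    fix s assume "s \<in> {0..N}"
    then have s: "s \<le> N" by simp
    show "w s * poly (P n) (x s) * poly (P m) (x s) = jacobi_norm u n *
          (poly (P (N - n) * P m) (x s) / (\<Prod>j\<in>{0..N} - {s}. x s - x j))"
      using jacobi_poly_reflect_spectral[OF s \<open>n \<le> N\<close>]
      unfolding jacobi_weight_eq[OF s] poly_mult times_divide_eq_left times_divide_eq_right
      by (metis mult.assoc)
  qed simp
  also have "\<dots> = jacobi_norm u n * coeff (P (N - n) * P m) N"
    using le degree_mult_le[of "P (N - n)" "P m"]
    by (subst sum_distrib_left[symmetric], subst spectral_divided_difference) auto
  also have "coeff (P (N - n) * P m) N = (if n = m then 1 else 0)"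
  proof (cases "n = m")
    case True
    then show ?thesis
      using le coeff_degree_mult[of "P (N - n)" "P m"] coeff_mult_degree_sum[of "P (N - n)" "P m"] by simp
  next
    case False
    then have "degree (P (N - n) * P m) < N"
      using le degree_mult_le[of "P (N - n)" "P m"] by simp
    with False show ?thesis by (simp add: coeff_eq_0)
  qed
  finally show ?case using le by (auto simp: mult_ac)
qed

lemma jacobi_alternating_sum:
  assumes "degree q < N"
  shows "(\<Sum>s=0..N. (- 1) ^ s * (w s * poly q (x s))) = 0"
proof -
  have "(\<Sum>s=0..N. (- 1) ^ s * (w s * poly q (x s)))
      = (\<Sum>s=0..N. (- 1) ^ N * sqrt (jacobi_norm u N) *
          (poly q (x s) / (\<Prod>j\<in>{0..N} - {s}. x s - x j)))"
  proof (rule sum.cong)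
    fix s assume "s \<in> {0..N}"
    then have s: "s \<le> N" by simp
    \<comment> \<open>The alternating sign and the sign of \<open>P N (x s)\<close> combine to a
      constant independent of \<open>s\<close>.\<close>
    then have "(- 1 :: real) ^ s * (- 1) ^ (N - s) = (- 1) ^ N"
      by (simp flip: power_add)
    then show "(- 1) ^ s * (w s * poly q (x s)) = (- 1) ^ N * sqrt (jacobi_norm u N) *
          (poly q (x s) / (\<Prod>j\<in>{0..N} - {s}. x s - x j))"
      unfolding jacobi_weight_eq[OF s] jacobi_poly_last[OF s] times_divide_eq_left times_divide_eq_right
      by (metis mult.assoc)
  qed simp
  also have "\<dots> = (- 1) ^ N * sqrt (jacobi_norm u N) * coeff q N"
    using assms by (subst sum_distrib_left[symmetric], subst spectral_divided_difference) auto
  finally show ?thesis using assms by (simp add: coeff_eq_0)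
qed

text \<open>The bound on \<open>n + m\<close> keeps the degree of \<open>P n * P m\<close> below
  \<open>N\<close>, so the alternating sum vanishes and the even and odd indices contribute equally
  to the full sum.\<close>

lemma jacobi_half_sums:
  assumes "n + m < N"
  defines "f \<equiv> \<lambda>s. w s * poly (P n) (x s) * poly (P m) (x s)"
  shows "N = 2 * L + 1 \<Longrightarrow> (\<Sum>s=0..L. f (2 * s)) = (if n = m then jacobi_norm u n / 2 else 0)"
    and "N = 2 * L + 1 \<Longrightarrow> (\<Sum>s=0..L. f (2 * s + 1)) = (if n = m then jacobi_norm u n / 2 else 0)"
    and "N = 2 * L \<Longrightarrow> (\<Sum>s=0..<L. f (2 * s + 1)) = (if n = m then jacobi_norm u n / 2 else 0)"
proof -
  have total: "(\<Sum>s=0..N. f s) = (if n = m then jacobi_norm u n else 0)"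
    unfolding f_def using assms(1) by (intro jacobi_orthogonality) auto
  have "degree (P n * P m) < N"
    using assms(1) degree_mult_le[of "P n" "P m"] by simp
  from jacobi_alternating_sum[OF this]
  have alt: "(\<Sum>s=0..N. (- 1) ^ s * f s) = 0" by (simp add: f_def mult.assoc)
  show "(\<Sum>s=0..L. f (2 * s)) = (if n = m then jacobi_norm u n / 2 else 0)"
    "(\<Sum>s=0..L. f (2 * s + 1)) = (if n = m then jacobi_norm u n / 2 else 0)" if "N = 2 * L + 1"
    using total alt unfolding that sum_split_even_odd
    by (auto simp: sum_negf split: if_splits)
  show "(\<Sum>s=0..<L. f (2 * s + 1)) = (if n = m then jacobi_norm u n / 2 else 0)" if "N = 2 * L"
    using total alt unfolding that sum_split_even_odd
    by (auto simp: sum_negf split: if_splits)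
qed

end

theorem lemma3p4:
  fixes N :: nat and a b u x w :: "nat \<Rightarrow> real" and P :: "nat \<Rightarrow> real poly"
  assumes "N \<ge> 1"
    and "\<forall>n\<in>{1..N}. u n > 0"
    and "\<forall>n\<in>{1..N}. (a n)\<^sup>2 = u n"
    and "persymmetric_coeffs N b a"
    and "spectral_points N b a x"
    and "P = jacobi_poly b u"
    and "w = jacobi_weight N b u x"
  shows "(\<forall>L. N = 2 * L + 1 \<longrightarrow>
      (\<forall>n\<in>{0..L}. \<forall>m\<in>{0..L}.
        (n \<noteq> m \<longrightarrow> (\<Sum>s=0..L. w (2*s) * poly (P n) (x (2*s)) * poly (P m) (x (2*s))) = 0) \<and>
        (n = m \<longrightarrow> (\<Sum>s=0..L. w (2*s) * poly (P n) (x (2*s)) * poly (P m) (x (2*s))) \<noteq> 0) \<and>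
        (n \<noteq> m \<longrightarrow> (\<Sum>s=0..L. w (2*s+1) * poly (P n) (x (2*s+1)) * poly (P m) (x (2*s+1))) = 0) \<and>
        (n = m \<longrightarrow> (\<Sum>s=0..L. w (2*s+1) * poly (P n) (x (2*s+1)) * poly (P m) (x (2*s+1))) \<noteq> 0))) \<and>
    (\<forall>L. N = 2 * L \<longrightarrow>
      (\<forall>n\<in>{0..<L}. \<forall>m\<in>{0..<L}.
        (n \<noteq> m \<longrightarrow> (\<Sum>s=0..<L. w (2*s+1) * poly (P n) (x (2*s+1)) * poly (P m) (x (2*s+1))) = 0) \<and>
        (n = m \<longrightarrow> (\<Sum>s=0..<L. w (2*s+1) * poly (P n) (x (2*s+1)) * poly (P m) (x (2*s+1))) \<noteq> 0)))"
proof -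
  have h: "jacobi_norm u n \<noteq> 0" if "n \<le> N" for n
    using jacobi_norm_pos[OF assms(2-5) that] by simp
  note half = jacobi_half_sums[OF assms(2-5), folded assms(6,7)]
  show ?thesis
  proof (intro conjI allI ballI impI)
    fix L n m
    assume N: "N = 2 * L + 1" and nm: "n \<in> {0..L}" "m \<in> {0..L}"
    \<comment> \<open>Indices up to \<open>L\<close> give \<open>n + m\<close> at most
      \<open>2 * L = N - 1\<close>.\<close>
    then have "n + m < N" by simp
    note even = half(1)[OF this N] and odd = half(2)[OF this N]
    show "(\<Sum>s=0..L. w (2*s) * poly (P n) (x (2*s)) * poly (P m) (x (2*s))) = 0"
      "(\<Sum>s=0..L. w (2*s+1) * poly (P n) (x (2*s+1)) * poly (P m) (x (2*s+1))) = 0" if "n \<noteq> m"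
      unfolding even odd using that by simp_all
    show "(\<Sum>s=0..L. w (2*s) * poly (P n) (x (2*s)) * poly (P m) (x (2*s))) \<noteq> 0"
      "(\<Sum>s=0..L. w (2*s+1) * poly (P n) (x (2*s+1)) * poly (P m) (x (2*s+1))) \<noteq> 0" if "n = m"
      unfolding even odd using that h N nm by simp_all
  next
    fix L n m
    assume N: "N = 2 * L" and nm: "n \<in> {0..<L}" "m \<in> {0..<L}"
    \<comment> \<open>Indices below \<open>L\<close> give \<open>n + m\<close> at most
      \<open>2 * L - 2 = N - 2\<close>.\<close>
    then have "n + m < N" by simp
    note odd = half(3)[OF this N]
    show "(\<Sum>s=0..<L. w (2*s+1) * poly (P n) (x (2*s+1)) * poly (P m) (x (2*s+1))) = 0" if "n \<noteq> m"
      unfolding odd using that by simp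
    show "(\<Sum>s=0..<L. w (2*s+1) * poly (P n) (x (2*s+1)) * poly (P m) (x (2*s+1))) \<noteq> 0" if "n = m"
      unfolding odd using that h N nm by simp
  qed
qed

end
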